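(* Let $N\geqslant2$ and $d>1$ be integers. The lowest energy $e_0$ (in the center-of-mass frame) of $N$ identical attractive Coulombian spinless particles in $d$ dimensions, with individual masses equal to unity and attractive pair potential $-1/r$, satisfies $$-\frac{1}{(d-1)^2}\,\frac{1}{4}\,N^2(N-1)\leqslant e_0.$$
   Context: The full Hamiltonian is $$\tilde H=-\frac12\sum_{i=0}^{N-1}\Delta_i-\sum_{0\leqslant i<j\leqslant N-1}\frac{1}{\|\vec r_j-\vec r_i\|}$$ acting on $\mathsf{L}^2(\mathbb{R}^{Nd})$, where $\vec r_i\in\mathbb{R}^d$ and $\Delta_i$ is the Laplacian in $\vec r_i$. The lowest energy $e_0$ is the smallest eigenvalue of the reduced Hamiltonian $H$ on $\mathsf{L}^2(\mathbb{R}^{(N-1)d})$ (functions of the relative coordinates $\vec r_1-\vec r_0,\dots,\vec r_{N-1}-\vec r_0$) obtained by removing the center-of-mass kinetic energy: $\tilde H=-\frac{1}{2N}\Delta_{\vec R}+H$ with $\vec R=\frac1N\sum_i\vec r_i$. *)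

theory Defs
  imports "HOL-Analysis.Analysis"
begin

section \<open>Test functions and the Sobolev space of order one\<close>

text \<open>
  Configurations of particles in \<open>d\<close>-dimensional space are elements of \<open>real^'d^'n\<close>, where
  \<open>'n\<close> indexes the particles (or relative coordinates) and \<open>d = CARD('d)\<close>. Elements of
  \<open>L\<^sup>2\<close> are represented by Borel functions; everything below depends on such a function only up
  to equality almost everywhere.
\<close>

definition square_integrable ::
    "('a::euclidean_space \<Rightarrow> 'b::euclidean_space) \<Rightarrow> bool" where
  "square_integrable u \<longleftrightarrow>
     u \<in> borel_measurable lborel \<and> integrable lborel (\<lambda>x. (norm (u x))\<^sup>2)"

definition L2_tendsto ::
    "(nat \<Rightarrow> 'a::euclidean_space \<Rightarrow> 'b::euclidean_space) \<Rightarrow> ('a \<Rightarrow> 'b) \<Rightarrow> bool" where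
  "L2_tendsto f u \<longleftrightarrow> (\<lambda>k. LINT x|lborel. (norm (f k x - u x))\<^sup>2) \<longlonglongrightarrow> 0"

primrec continuously_differentiable ::
    "nat \<Rightarrow> ('a::euclidean_space \<Rightarrow> complex) \<Rightarrow> bool" where
  "continuously_differentiable 0 f \<longleftrightarrow> continuous_on UNIV f"
| "continuously_differentiable (Suc k) f \<longleftrightarrow>
     (\<forall>x. f differentiable (at x)) \<and>
     (\<forall>b\<in>Basis. continuously_differentiable k (\<lambda>x. frechet_derivative f (at x) b))"

definition test_function :: "('a::euclidean_space \<Rightarrow> complex) \<Rightarrow> bool" where
  "test_function f \<longleftrightarrow>
     (\<forall>k. continuously_differentiable k f) \<and> compact (closure {x. f x \<noteq> 0})"

definition gradient ::
    "(real^'d^'n \<Rightarrow> complex) \<Rightarrow> real^'d^'n \<Rightarrow> complex^'d^'n" where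
  "gradient f x = (\<chi> i a. frechet_derivative f (at x) (axis i (axis a 1)))"

text \<open>
  The function \<open>u\<close> lies in \<open>H\<^sup>1\<close>, the closure of the test functions in the norm
  \<open>(\<parallel>u\<parallel>\<^sup>2 + \<parallel>\<nabla>u\<parallel>\<^sup>2)\<^bsup>1/2\<^esup>\<close>, and has the generalised gradient \<open>G\<close>,
  which is unique almost everywhere.
\<close>

definition H1_gradient ::
    "(real^'d^'n \<Rightarrow> complex) \<Rightarrow> (real^'d^'n \<Rightarrow> complex^'d^'n) \<Rightarrow> bool" where
  "H1_gradient u G \<longleftrightarrow>
     square_integrable u \<and> square_integrable G \<and>
     (\<exists>\<phi>. (\<forall>k. test_function (\<phi> k)) \<and>
          L2_tendsto \<phi> u \<and> L2_tendsto (\<lambda>k. gradient (\<phi> k)) G)"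


section \<open>The Hamiltonian in the center-of-mass frame\<close>

text \<open>
  The sum over \<open>i < j\<close> is written as half the sum over ordered pairs of distinct particles.
\<close>

definition coulomb :: "real^'d^'p \<Rightarrow> real" where
  "coulomb r = - (1/2) * (\<Sum>i\<in>UNIV. \<Sum>j\<in>UNIV - {i}. 1 / norm (r $ j - r $ i))"

text \<open>
  The \<open>N\<close> particles are indexed by \<open>'n option\<close>: \<open>None\<close> is particle \<open>0\<close>, and
  \<open>x $ i\<close> is the position of particle \<open>Some i\<close> relative to particle \<open>0\<close>. Hence
  \<open>N = CARD('n) + 1\<close>. Placing particle \<open>0\<close> at the origin turns relative coordinates into a
  configuration of all \<open>N\<close> particles.
\<close>

definition configuration :: "real^'d^'n \<Rightarrow> real^'d^('n::finite option)" where
  "configuration x = (\<chi> k. case k of None \<Rightarrow> 0 | Some i \<Rightarrow> x $ i)"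

text \<open>
  For a function \<open>\<Psi> r = \<psi> (r\<^sub>1 - r\<^sub>0, \<dots>)\<close> of the relative coordinates alone, the
  gradient in \<open>r\<^sub>i\<close> is \<open>\<nabla>\<^sub>i \<psi>\<close> for \<open>i \<ge> 1\<close>, and the gradient in \<open>r\<^sub>0\<close> is
  \<open>- \<Sum>\<^sub>i \<nabla>\<^sub>i \<psi>\<close>.
\<close>

definition particle_gradients :: "complex^'d^'n \<Rightarrow> complex^'d^('n::finite option)" where
  "particle_gradients G = (\<chi> k. case k of None \<Rightarrow> - (\<Sum>i\<in>UNIV. G $ i) | Some i \<Rightarrow> G $ i)"

text \<open>
  The sesquilinear form of the reduced Hamiltonian. The gradients \<open>G\<close> and \<open>K\<close> of \<open>u\<close> and
  \<open>v\<close> are passed explicitly. Lemma \<open>center_of_mass_separation\<close> below shows that its energy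
  density is that of the full Hamiltonian without the center-of-mass term \<open>|\<nabla>\<^sub>R|\<^sup>2 / (2 N)\<close>.
\<close>

definition energy_form ::
    "(real^'d^'n \<Rightarrow> complex) \<Rightarrow> (real^'d^'n \<Rightarrow> complex^'d^'n) \<Rightarrow>
     (real^'d^'n \<Rightarrow> complex) \<Rightarrow> (real^'d^'n \<Rightarrow> complex^'d^'n) \<Rightarrow> complex" where
  "energy_form u G v K =
     (LINT x|lborel.
        1/2 * (\<Sum>k\<in>UNIV. \<Sum>a\<in>UNIV.
                 particle_gradients (G x) $ k $ a * cnj (particle_gradients (K x) $ k $ a))
        + of_real (coulomb (configuration x)) * u x * cnj (v x))"

text \<open>
  The graph of the self-adjoint operator associated with this form on \<open>H\<^sup>1\<close>: \<open>H u = f\<close> iff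
  \<open>u\<close> is in the form domain and the form at \<open>(u, v)\<close> is the inner product of \<open>f\<close> and \<open>v\<close>
  for all \<open>v\<close> in the form domain. The operator is defined through the form because for
  \<open>d = 2\<close> the Coulomb potential is not locally square integrable, so that \<open>H\<close> is not defined
  on the test functions as an operator, whereas the form is, for all \<open>d \<ge> 2\<close>.
\<close>

definition reduced_hamiltonian :: "(real^'d^'n \<Rightarrow> complex) rel" where
  "reduced_hamiltonian =
     {(u, f). square_integrable f \<and>
        (\<exists>G. H1_gradient u G \<and>
          (\<forall>v K. H1_gradient v K \<longrightarrow>
             energy_form u G v K = (LINT x|lborel. f x * cnj (v x))))}"

definition eigenvalue :: "('a::euclidean_space \<Rightarrow> complex) rel \<Rightarrow> complex \<Rightarrow> bool" where
  "eigenvalue T e \<longleftrightarrow>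
     (\<exists>u. square_integrable u \<and> \<not> (AE x in lborel. u x = 0) \<and> (u, \<lambda>x. e * u x) \<in> T)"

definition smallest_eigenvalue :: "('a::euclidean_space \<Rightarrow> complex) rel \<Rightarrow> real \<Rightarrow> bool" where
  "smallest_eigenvalue T e0 \<longleftrightarrow>
     eigenvalue T (of_real e0) \<and> (\<forall>e::real. eigenvalue T (of_real e) \<longrightarrow> e0 \<le> e)"


section \<open>Separation of the center of mass\<close>

definition center_of_mass :: "real^'d^('n::finite option) \<Rightarrow> real^'d" where
  "center_of_mass r = (1 / (real CARD('n) + 1)) *\<^sub>R (\<Sum>k\<in>UNIV. r $ k)"

definition relative_coordinates :: "real^'d^('n::finite option) \<Rightarrow> real^'d^'n" where
  "relative_coordinates r = (\<chi> i. r $ Some i - r $ None)"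

lemma sum_option:
  fixes f :: "'n::finite option \<Rightarrow> 'b::comm_monoid_add"
  shows "(\<Sum>k\<in>UNIV. f k) = f None + (\<Sum>i\<in>UNIV. f (Some i))"
  by (simp add: UNIV_option_conv sum.reindex)

lemma coulomb_translation_invariant:
  "coulomb (configuration (relative_coordinates r)) = coulomb r"
proof -
  have "configuration (relative_coordinates r) $ j - configuration (relative_coordinates r) $ i
        = r $ j - r $ i" for i j
    by (simp add: configuration_def relative_coordinates_def split: option.split)
  then show ?thesis by (simp add: coulomb_def)
qed

lemma sum_norm_particle_gradients:
  fixes c :: "complex^'d" and G :: "complex^'d^'n"
  shows "(\<Sum>k\<in>UNIV. (norm ((1 / (real CARD('n) + 1)) *\<^sub>R c + particle_gradients G $ k))\<^sup>2) =
    (1 / (real CARD('n) + 1)) * (norm c)\<^sup>2 + (\<Sum>k\<in>UNIV. (norm (particle_gradients G $ k))\<^sup>2)"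
proof -
  define m where "m = 1 / (real CARD('n) + 1)"
  have norm_add: "(norm (m *\<^sub>R c + v))\<^sup>2 = m\<^sup>2 * (norm c)\<^sup>2 + 2 * m * (c \<bullet> v) + (norm v)\<^sup>2" for v
    using dot_norm[of "m *\<^sub>R c" v] by (simp add: power_mult_distrib)
  let ?g = "\<lambda>k. particle_gradients G $ k"
  have g0: "(\<Sum>k\<in>UNIV. ?g k) = 0"
    by (simp add: sum_option particle_gradients_def)
  have "(\<Sum>k\<in>UNIV. (norm (m *\<^sub>R c + ?g k))\<^sup>2) =
        (\<Sum>k\<in>(UNIV::'n option set). m\<^sup>2 * (norm c)\<^sup>2 + 2 * m * (c \<bullet> ?g k) + (norm (?g k))\<^sup>2)"
    by (intro sum.cong refl) (simp add: norm_add power_mult_distrib)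
  also have "\<dots> = real (CARD('n option)) * (m\<^sup>2 * (norm c)\<^sup>2) + 2 * m * (c \<bullet> (\<Sum>k\<in>UNIV. ?g k))
        + (\<Sum>k\<in>UNIV. (norm (?g k))\<^sup>2)"
    by (simp add: sum.distrib sum_distrib_left inner_sum_right)
  also have "real (CARD('n option)) * (m\<^sup>2 * (norm c)\<^sup>2) = m * (norm c)\<^sup>2"
  proof -
    have "real (CARD('n option)) * m = 1"
      by (simp add: m_def divide_simps)
    then have "real (CARD('n option)) * m * (m * (norm c)\<^sup>2) = m * (norm c)\<^sup>2"
      by (simp only: mult_1_left)
    then show ?thesis by (simp only: power2_eq_square mult.assoc)
  qed
  finally show ?thesis using g0 by (simp add: m_def)
qed

text \<open>
  With \<open>R\<close> the center of mass and \<open>x\<close> the relative coordinates, the energy density of the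
  full Hamiltonian at \<open>\<Psi>(r) = F(R, x)\<close> is the center-of-mass kinetic energy density plus the
  density of \<open>energy_form\<close>.
\<close>

lemma center_of_mass_separation:
  fixes F :: "(real^'d) \<times> (real^'d^'n) \<Rightarrow> complex" and r :: "real^'d^('n::finite option)"
  defines "\<Psi> \<equiv> \<lambda>r. F (center_of_mass r, relative_coordinates r)"
    and "R \<equiv> center_of_mass r" and "x \<equiv> relative_coordinates r"
  assumes F: "F differentiable (at (R, x))"
  shows "1/2 * (\<Sum>k\<in>UNIV. (norm (gradient \<Psi> r $ k))\<^sup>2) + coulomb r * (norm (\<Psi> r))\<^sup>2 =
    1 / (2 * (real CARD('n) + 1)) * (norm (\<chi> a. frechet_derivative F (at (R, x)) (axis a 1, 0)))\<^sup>2
    + (1/2 * (\<Sum>k\<in>UNIV. (norm (particle_gradients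
                (\<chi> i a. frechet_derivative F (at (R, x)) (0, axis i (axis a 1))) $ k))\<^sup>2)
       + coulomb (configuration x) * (norm (F (R, x)))\<^sup>2)"
proof -
  let ?m = "1 / (real CARD('n) + 1)"
  define D where "D = frechet_derivative F (at (R, x))"
  define L :: "real^'d^('n::finite option) \<Rightarrow> (real^'d) \<times> (real^'d^'n)"
    where "L = (\<lambda>r. (center_of_mass r, relative_coordinates r))"
  define c :: "complex^'d" where "c = (\<chi> a. D (axis a 1, 0))"
  define G :: "complex^'d^'n" where "G = (\<chi> i a. D (0, axis i (axis a 1)))"
  have linL: "linear L"
    by (rule linearI)
       (simp_all add: L_def center_of_mass_def relative_coordinates_def vec_eq_iff sum.distrib
          algebra_simps flip: scaleR_sum_right)
  have DF: "(F has_derivative D) (at (L r))"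
    using F frechet_derivative_works by (auto simp: D_def L_def R_def x_def)
  have linD: "linear D" using DF has_derivative_linear by blast
  have \<Psi>L: "\<Psi> = F \<circ> L" by (auto simp: \<Psi>_def L_def)
  have "(\<Psi> has_derivative D \<circ> L) (at r)"
    unfolding \<Psi>L using linear_imp_has_derivative[OF linL] DF by (rule diff_chain_at)
  then have fd: "frechet_derivative \<Psi> (at r) = D \<circ> L"
    by (metis frechet_derivative_at)
  have com: "center_of_mass (axis k (axis a 1) :: real^'d^('n option)) = ?m *\<^sub>R axis a 1" for k a
    by (simp add: center_of_mass_def axis_def if_distrib[of "\<lambda>v. v $ _"] vec_eq_iff
          cong: if_cong)
  have relS: "relative_coordinates (axis (Some i) (axis a 1)) = (axis i (axis a 1) :: real^'d^'n)"
    for i a by (auto simp: relative_coordinates_def axis_def vec_eq_iff)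
  have relN: "relative_coordinates (axis None (axis a 1) :: real^'d^('n option)) =
      - (\<Sum>i\<in>UNIV. axis i (axis a 1))" for a
    by (auto simp: relative_coordinates_def axis_def vec_eq_iff if_distrib[of "\<lambda>v. v $ _"]
          cong: if_cong)
  have DL: "D (?m *\<^sub>R axis a 1, q) = ?m *\<^sub>R c $ a + D (0, q)" for a q
    using linear_add[OF linD, of "(?m *\<^sub>R axis a 1, 0)" "(0, q)"]
      linear_scale[OF linD, of ?m "(axis a 1, 0)"] by (simp add: c_def)
  have lin2: "linear (\<lambda>q. D (0, q))"
    using linear_compose[of "\<lambda>q. (0, q)" D] linD
    by (simp add: o_def linear_iff)
  have grad: "gradient \<Psi> r $ k = ?m *\<^sub>R c + particle_gradients G $ k" for k
  proof (cases k)
    case None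
    have "D (0, - (\<Sum>i\<in>UNIV. axis i (axis a 1))) = - (\<Sum>i\<in>UNIV. D (0, axis i (axis a 1)))" for a
      using linear_neg[OF lin2] linear_sum[OF lin2] by simp
    then have "gradient \<Psi> r $ None $ a = (?m *\<^sub>R c + particle_gradients G $ None) $ a" for a
      unfolding gradient_def fd
      by (simp only: vec_lambda_beta o_def L_def com relN DL)
         (simp add: particle_gradients_def G_def)
    then show ?thesis unfolding None vec_eq_iff by blast
  next
    case (Some i)
    have "gradient \<Psi> r $ Some i $ a = (?m *\<^sub>R c + particle_gradients G $ Some i) $ a" for a
      unfolding gradient_def fd
      by (simp only: vec_lambda_beta o_def L_def com relS DL)
         (simp add: particle_gradients_def G_def)
    then show ?thesis unfolding Some vec_eq_iff by blast
  qed
  have "(\<Sum>k\<in>UNIV. (norm (gradient \<Psi> r $ k))\<^sup>2) =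
      ?m * (norm c)\<^sup>2 + (\<Sum>k\<in>UNIV. (norm (particle_gradients G $ k))\<^sup>2)"
    unfolding grad by (rule sum_norm_particle_gradients)
  then have "1/2 * (\<Sum>k\<in>UNIV. (norm (gradient \<Psi> r $ k))\<^sup>2) =
      1 / (2 * (real CARD('n) + 1)) * (norm c)\<^sup>2
      + 1/2 * (\<Sum>k\<in>UNIV. (norm (particle_gradients G $ k))\<^sup>2)"
    by (simp only: distrib_left) (simp add: divide_simps)
  then show ?thesis
    by (simp only: c_def G_def D_def x_def R_def \<Psi>_def coulomb_translation_invariant add.assoc)
qed

end

theory Submission imports Defs begin

text \<open>
  The Hamiltonian in the center-of-mass frame is a sum of two-body Hamiltonians, and each of them
  is a hydrogen atom whose ground state energy is known. Write \<open>p\<^sub>k\<close> for the momentum of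
  particle \<open>k\<close>. Without total momentum, the kinetic energy satisfies
  \<open>1/2 \<Sum>\<^sub>k \<bar>p\<^sub>k\<bar>\<^sup>2 = 1/(2N) \<Sum>\<^sub>i\<^sub><\<^sub>j \<bar>p\<^sub>i - p\<^sub>j\<bar>\<^sup>2\<close> (lemma \<open>energy_density_pairs\<close>), and
  \<open>\<pi> = (p\<^sub>i - p\<^sub>j)/2\<close> is conjugate to the separation \<open>r = r\<^sub>i - r\<^sub>j\<close>. Hence the energy is the sum
  over the \<open>N (N - 1)/2\<close> pairs of the energies of \<open>(2/N) \<bar>\<pi>\<bar>\<^sup>2 - 1/\<bar>r\<bar>\<close>, each of which is
  bounded below by \<open>- N/(2 (d - 1)\<^sup>2)\<close>.

  The bound for a pair is an uncertainty inequality. The unit radial field \<open>r/\<bar>r\<bar>\<close> has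
  divergence \<open>(d - 1)/\<bar>r\<bar>\<close>, so integration by parts gives
  \<open>(d - 1) \<integral> \<bar>u\<bar>\<^sup>2/\<bar>r\<bar> \<le> 2 \<integral> \<bar>u\<bar> \<bar>\<pi> u\<bar> \<le> c \<integral> \<bar>\<pi> u\<bar>\<^sup>2 + (1/c) \<integral> \<bar>u\<bar>\<^sup>2\<close>
  for every \<open>c > 0\<close>, and \<open>c = 2 (d - 1)/N\<close> is the choice that matches the kinetic energy.
  To stay away from the singularity, \<open>\<bar>r\<bar>\<close> is first replaced by \<open>sqrt (\<bar>r\<bar>\<^sup>2 + \<epsilon>\<^sup>2)\<close>: the
  inequality is proved for test functions (\<open>smoothed_coulomb_bound_test_function\<close>), extended to
  \<open>H\<^sup>1\<close> by density while the potential is still bounded (\<open>smoothed_pair_bound\<close>), and freed of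
  \<open>\<epsilon>\<close> by monotone convergence (\<open>pair_bound\<close>).

  An eigenfunction \<open>u\<close> with eigenvalue \<open>e\<close> lies in the form domain, so testing the eigenvalue
  equation with \<open>u\<close> itself identifies \<open>e \<parallel>u\<parallel>\<^sup>2\<close> with the energy of \<open>u\<close>.
\<close>

section \<open>Integration by parts for compactly supported functions\<close>

lemma integrable_continuous_compact_support:
  fixes f :: "'a::euclidean_space \<Rightarrow> 'b::euclidean_space"
  assumes "continuous_on UNIV f" and "\<And>x. x \<notin> cball 0 R \<Longrightarrow> f x = 0"
  shows "integrable lborel f"
proof -
  have "integrable lborel (\<lambda>x. indicator (cball 0 R) x *\<^sub>R f x)"
    by (rule borel_integrable_compact) (use assms(1) continuous_on_subset in auto)
  moreover have "(\<lambda>x. indicator (cball 0 R) x *\<^sub>R f x) = f"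
    by (rule ext) (use assms(2) in \<open>simp add: indicator_def\<close>)
  ultimately show ?thesis by simp
qed

lemma lborel_translation:
  fixes f :: "'a::euclidean_space \<Rightarrow> real"
  assumes "f \<in> borel_measurable borel"
  shows "(LINT x|lborel. f (x + v)) = (LINT x|lborel. f x)"
proof -
  have "(LINT x|lborel. f x) = (LINT x|distr lborel borel ((+) v). f x)"
    by (simp add: lborel_distr_plus)
  also have "\<dots> = (LINT x|lborel. f (v + x))"
    using assms by (subst integral_distr) auto
  finally show ?thesis by (simp add: add.commute)
qed

text \<open>
  Integration by parts without boundary term. The difference quotients of \<open>h\<close> in the direction
  \<open>w\<close> have integral 0 because Lebesgue measure is translation invariant. By the mean value
  theorem they are bounded by the supremum of \<open>\<bar>h'\<bar>\<close>, and they vanish outside a common ball, so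
  dominated convergence carries the value 0 over to the limit \<open>h'\<close>. Asking only for the
  derivative along \<open>w\<close> avoids computing a full derivative of the products to which this is
  applied.
\<close>

lemma integral_directional_derivative_eq_0:
  fixes h h' :: "'a::euclidean_space \<Rightarrow> real"
  assumes der: "\<And>x. ((\<lambda>t. h (x + t *\<^sub>R w)) has_real_derivative h' x) (at 0)"
    and cont: "continuous_on UNIV h" "continuous_on UNIV h'"
    and supp: "\<And>x. x \<notin> cball 0 R \<Longrightarrow> h x = 0" "\<And>x. x \<notin> cball 0 R \<Longrightarrow> h' x = 0"
  shows "(LINT x|lborel. h' x) = 0"
proof -
  define t where "t n = inverse (real (Suc n))" for n
  have t: "0 < t n" "t n \<le> 1" for n
    by (auto simp: t_def field_simps)
  have t0: "t \<longlonglongrightarrow> 0" unfolding t_def by (rule LIMSEQ_inverse_real_of_nat)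
  define q where "q n x = (h (x + t n *\<^sub>R w) - h x) / t n" for n x
  have "bounded (h' ` cball 0 R)"
    by (intro compact_imp_bounded compact_continuous_image continuous_on_subset[OF cont(2)]) auto
  then obtain B where B0: "B > 0" and "\<And>x. x \<in> cball 0 R \<Longrightarrow> norm (h' x) \<le> B"
    by (auto simp: bounded_pos)
  then have B: "\<bar>h' x\<bar> \<le> B" for x
    using supp(2)[of x] by (cases "x \<in> cball 0 R") auto
  have der': "((\<lambda>t. h (x + t *\<^sub>R w)) has_real_derivative h' (x + s *\<^sub>R w)) (at s)" for x s
    using der[of "x + s *\<^sub>R w"] DERIV_shift[of "\<lambda>t. h (x + t *\<^sub>R w)" "h' (x + s *\<^sub>R w)" 0 s]
    by (simp add: algebra_simps)
  have q_bound: "norm (q n x) \<le> indicator (cball 0 (R + norm w)) x *\<^sub>R B" for n x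
  proof (cases "x \<in> cball 0 (R + norm w)")
    case True
    obtain s where "h (x + t n *\<^sub>R w) - h (x + 0 *\<^sub>R w) = (t n - 0) * h' (x + s *\<^sub>R w)"
      using MVT2[OF t(1)[of n], of "\<lambda>t. h (x + t *\<^sub>R w)" "\<lambda>s. h' (x + s *\<^sub>R w)"] der' by blast
    then have "q n x = h' (x + s *\<^sub>R w)"
      using t(1)[of n] by (simp add: q_def)
    then show ?thesis using True B by simp
  next
    case False
    have "norm (t n *\<^sub>R w) \<le> norm w"
      using t[of n] by (simp add: mult_left_le_one_le)
    moreover have "norm x \<le> norm (x + t n *\<^sub>R w) + norm (t n *\<^sub>R w)"
      by (metis add_diff_cancel_right' norm_triangle_ineq4)
    ultimately have "norm x > R" "norm (x + t n *\<^sub>R w) > R"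
      using False norm_ge_zero[of w] by (simp_all del: norm_ge_zero norm_scaleR)
    then have "h (x + t n *\<^sub>R w) = 0" "h x = 0"
      by (simp_all add: supp(1))
    then show ?thesis using B0 by (simp add: q_def)
  qed
  have q_lim: "(\<lambda>n. q n x) \<longlonglongrightarrow> h' x" for x
  proof -
    have "((\<lambda>s. (h (x + s *\<^sub>R w) - h x) / s) \<longlongrightarrow> h' x) (at 0)"
      using der[of x] by (simp add: has_field_derivative_iff)
    moreover have "filterlim t (at 0) sequentially"
      using t0 t(1) by (simp add: filterlim_at less_imp_neq[symmetric])
    ultimately show ?thesis unfolding q_def by (rule filterlim_compose)
  qed
  have hm: "h \<in> borel_measurable borel" "h' \<in> borel_measurable borel"
    using cont by (auto intro: borel_measurable_continuous_onI)
  have hi: "integrable lborel h" 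
    using integrable_continuous_compact_support[OF cont(1) supp(1)] .
  have "(\<lambda>n. LINT x|lborel. q n x) \<longlonglongrightarrow> (LINT x|lborel. h' x)"
  proof (rule integral_dominated_convergence)
    show "integrable lborel (\<lambda>x. indicator (cball 0 (R + norm w)) x *\<^sub>R B)"
      by (rule borel_integrable_compact) auto
    show "q n \<in> borel_measurable lborel" for n
      unfolding q_def using hm(1) by simp
    show "h' \<in> borel_measurable lborel" using hm by simp
    show "AE x in lborel. (\<lambda>n. q n x) \<longlonglongrightarrow> h' x" using q_lim by (intro AE_I2)
    show "AE x in lborel. norm (q n x) \<le> indicator (cball 0 (R + norm w)) x *\<^sub>R B" for n
      by (intro AE_I2 q_bound)
  qed
  moreover have "(LINT x|lborel. q n x) = 0" for n
  proof -
    have "integrable lborel (\<lambda>x. h (x + t n *\<^sub>R w))"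
    proof (rule integrable_continuous_compact_support)
      show "continuous_on UNIV (\<lambda>x. h (x + t n *\<^sub>R w))"
        by (rule continuous_on_compose2[OF cont(1)]) (auto intro!: continuous_intros)
      show "h (x + t n *\<^sub>R w) = 0" if "x \<notin> cball 0 (R + norm (t n *\<^sub>R w))" for x
      proof -
        have "norm x \<le> norm (x + t n *\<^sub>R w) + norm (t n *\<^sub>R w)"
          by (metis add_diff_cancel_right' norm_triangle_ineq4)
        then show ?thesis using that by (intro supp(1)) (simp del: norm_scaleR)
      qed
    qed
    then show ?thesis unfolding q_def
      using hi lborel_translation[OF hm(1), of "t n *\<^sub>R w"] by simp
  qed
  ultimately show ?thesis by (simp add: LIMSEQ_const_iff)
qed

section \<open>Test functions\<close>

lemma test_function_differentiable:
  assumes "test_function f"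
  shows "continuous_on UNIV f" and "f differentiable (at x)"
    and "b \<in> Basis \<Longrightarrow> continuous_on UNIV (\<lambda>x. frechet_derivative f (at x) b)"
proof -
  have k: "continuously_differentiable k f" for k
    using assms by (simp add: test_function_def)
  show "continuous_on UNIV f" using k[of 0] by simp
  show "f differentiable (at x)"
    and "b \<in> Basis \<Longrightarrow> continuous_on UNIV (\<lambda>x. frechet_derivative f (at x) b)"
    using k[of "Suc 0"] by simp_all
qed

lemma test_function_has_derivative:
  "test_function f \<Longrightarrow> (f has_derivative frechet_derivative f (at x)) (at x)"
  using test_function_differentiable(2) frechet_derivative_works by blast

lemma test_function_continuous_derivative:
  assumes "test_function f"
  shows "continuous_on UNIV (\<lambda>x. frechet_derivative f (at x) w)"
proof -
  have "frechet_derivative f (at x) w = (\<Sum>b\<in>Basis. (w \<bullet> b) *\<^sub>R frechet_derivative f (at x) b)" for x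
  proof -
    interpret linear "frechet_derivative f (at x)"
      using test_function_has_derivative[OF assms] has_derivative_linear by blast
    have "frechet_derivative f (at x) (\<Sum>b\<in>Basis. (w \<bullet> b) *\<^sub>R b) =
        (\<Sum>b\<in>Basis. (w \<bullet> b) *\<^sub>R frechet_derivative f (at x) b)"
      by (simp only: sum scaleR)
    then show ?thesis by (simp only: euclidean_representation)
  qed
  then show ?thesis
    using test_function_differentiable(3)[OF assms] by (auto intro!: continuous_intros)
qed

lemma test_function_support:
  assumes "test_function f"
  shows "\<exists>R. \<forall>x. x \<notin> cball 0 R \<longrightarrow> f x = 0 \<and> (\<forall>w. frechet_derivative f (at x) w = 0)"
proof -
  have "bounded (closure {x. f x \<noteq> 0})"
    using assms by (intro compact_imp_bounded) (simp add: test_function_def)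
  then obtain R where "\<forall>x\<in>closure {x. f x \<noteq> 0}. norm x \<le> R"
    unfolding bounded_iff ..
  then have R: "norm x \<le> R" if "x \<in> closure {x. f x \<noteq> 0}" for x
    using that by (rule bspec)
  have z: "f x = 0" if "x \<notin> cball 0 R" for x
  proof (rule ccontr)
    assume "f x \<noteq> 0"
    then have "x \<in> closure {x. f x \<noteq> 0}" by (intro subsetD[OF closure_subset] CollectI)
    then show False using R[of x] that by simp
  qed
  have dz: "frechet_derivative f (at x) w = 0" if "x \<notin> cball 0 R" for x w
  proof -
    have "(f has_derivative (\<lambda>_. 0)) (at x)"
    proof (rule has_derivative_transform_within_open)
      show "((\<lambda>_. 0) has_derivative (\<lambda>_. 0)) (at x)" by (rule has_derivative_const)
      show "open (- cball 0 R)" by (intro open_Compl closed_cball)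
      show "x \<in> - cball 0 R" using that by simp
      show "0 = f y" if "y \<in> - cball 0 R" for y using z[of y] that by simp
    qed
    then have "frechet_derivative f (at x) = (\<lambda>_. 0)"
      by (rule frechet_derivative_at[symmetric])
    then show ?thesis by simp
  qed
  show ?thesis by (intro exI[of _ R] allI impI conjI z dz)
qed

section \<open>The Coulomb uncertainty inequality for test functions\<close>

lemma norm_add_power2:
  fixes u v :: "'a::real_inner"
  shows "(norm (u + v))\<^sup>2 = (norm u)\<^sup>2 + 2 * (u \<bullet> v) + (norm v)\<^sup>2"
  by (simp add: power2_norm_eq_inner inner_add inner_commute)

text \<open>
  Completing a square: this is \<open>0 \<le> c * (norm ((s / c) *\<^sub>R u + v))\<^sup>2\<close>. The free weight \<open>c\<close>
  is what later allows the best balance between kinetic and potential energy.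
\<close>

lemma weighted_inner_bound:
  fixes u v :: "'a::real_inner"
  assumes "c > 0"
  shows "- (s * (2 * (u \<bullet> v))) \<le> c * (norm v)\<^sup>2 + s\<^sup>2 * (norm u)\<^sup>2 / c"
proof -
  have "0 \<le> (norm ((s / c) *\<^sub>R u + v))\<^sup>2" by simp
  also have "\<dots> = (s / c)\<^sup>2 * (norm u)\<^sup>2 + (s / c) * (2 * (u \<bullet> v)) + (norm v)\<^sup>2"
    by (simp add: norm_add_power2 power_mult_distrib power_divide)
  finally have "0 \<le> c * \<dots>" using assms by simp
  also have "\<dots> = s\<^sup>2 * (norm u)\<^sup>2 / c + s * (2 * (u \<bullet> v)) + c * (norm v)\<^sup>2"
    using assms by (simp add: field_simps power2_eq_square)
  finally show ?thesis by simp
qed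

text \<open>
  The diagonal entries of the Jacobian of the regularised radial field
  \<open>r \<mapsto> r / sqrt (\<bar>r\<bar>\<^sup>2 + \<epsilon>\<^sup>2)\<close>. Their sum is its divergence
  \<open>d / \<rho> - \<bar>r\<bar>\<^sup>2 / \<rho>\<^sup>3\<close>, which is at least \<open>(d - 1) / \<rho>\<close>: the origin of the factor
  \<open>d - 1\<close> in the final bound.
\<close>

lemma has_real_derivative_smoothed_unit_vector:
  fixes r :: "real^'d"
  assumes "\<epsilon> > 0"
  defines "\<rho> \<equiv> sqrt ((norm r)\<^sup>2 + \<epsilon>\<^sup>2)"
  shows "((\<lambda>t. (r + t *\<^sub>R axis a 1) $ a / sqrt ((norm (r + t *\<^sub>R axis a 1))\<^sup>2 + \<epsilon>\<^sup>2))
           has_real_derivative (1 / \<rho> - (r $ a)\<^sup>2 / \<rho> ^ 3)) (at 0)"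
proof -
  have n: "(norm (r + t *\<^sub>R axis a 1))\<^sup>2 = (norm r)\<^sup>2 + 2 * t * r $ a + t\<^sup>2" for t
    by (simp add: norm_add_power2 inner_axis power_mult_distrib)
  have pos: "(norm r)\<^sup>2 + \<epsilon>\<^sup>2 > 0" using assms by (simp add: add_nonneg_pos)
  then have \<rho>: "\<rho> > 0" by (simp add: \<rho>_def)
  have "((\<lambda>t. sqrt ((norm r)\<^sup>2 + 2 * t * r $ a + t\<^sup>2 + \<epsilon>\<^sup>2)) has_real_derivative r $ a / \<rho>) (at 0)"
    using pos by (auto intro!: derivative_eq_intros simp: \<rho>_def field_simps)
  moreover have "((\<lambda>t. r $ a + t) has_real_derivative 1) (at 0)"
    by (auto intro!: derivative_eq_intros)
  moreover have s0: "sqrt ((norm r)\<^sup>2 + 2 * 0 * r $ a + 0\<^sup>2 + \<epsilon>\<^sup>2) = \<rho>"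
    by (simp add: \<rho>_def)
  ultimately have "((\<lambda>t. (r $ a + t) / sqrt ((norm r)\<^sup>2 + 2 * t * r $ a + t\<^sup>2 + \<epsilon>\<^sup>2)) has_real_derivative
      (1 * \<rho> - (r $ a + 0) * (r $ a / \<rho>)) / (\<rho> * \<rho>)) (at 0)"
    using DERIV_divide[of "\<lambda>t. r $ a + t" 1 0 UNIV
      "\<lambda>t. sqrt ((norm r)\<^sup>2 + 2 * t * r $ a + t\<^sup>2 + \<epsilon>\<^sup>2)" "r $ a / \<rho>"] \<rho>
    unfolding s0 by simp
  moreover have "(1 * \<rho> - (r $ a + 0) * (r $ a / \<rho>)) / (\<rho> * \<rho>) = 1 / \<rho> - (r $ a)\<^sup>2 / \<rho> ^ 3"
    using \<rho> by (simp add: field_simps power2_eq_square power3_eq_cube)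
  ultimately show ?thesis by (simp add: n)
qed

lemma has_real_derivative_norm_power2_along:
  fixes f :: "'a::real_normed_vector \<Rightarrow> 'b::real_inner"
  assumes "(f has_derivative f') (at x)"
  shows "((\<lambda>t. (norm (f (x + t *\<^sub>R w)))\<^sup>2) has_real_derivative 2 * (f x \<bullet> f' w)) (at 0)"
proof -
  interpret f': bounded_linear f' using assms by (rule has_derivative_bounded_linear)
  have l: "((\<lambda>t. x + t *\<^sub>R w) has_derivative (\<lambda>t. t *\<^sub>R w)) (at 0)"
    by (auto intro!: derivative_eq_intros)
  have d: "((\<lambda>t. f (x + t *\<^sub>R w)) has_derivative (\<lambda>t. t *\<^sub>R f' w)) (at 0)"
    using diff_chain_at[OF l, of f f'] assms by (simp add: o_def f'.scaleR)
  have "((\<lambda>t. f (x + t *\<^sub>R w) \<bullet> f (x + t *\<^sub>R w)) has_derivative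
          (\<lambda>t. f (x + 0 *\<^sub>R w) \<bullet> (t *\<^sub>R f' w) + (t *\<^sub>R f' w) \<bullet> f (x + 0 *\<^sub>R w))) (at 0)"
    by (rule has_derivative_inner[OF d d])
  then show ?thesis
    unfolding has_field_derivative_def power2_norm_eq_inner
    by (rule has_derivative_eq_rhs) (simp add: fun_eq_iff inner_commute algebra_simps)
qed

text \<open>
  Here \<open>L x\<close> is the separation of two particles, and the displacement \<open>w a\<close> increases its
  \<open>a\<close>-th coordinate at unit speed; so \<open>-\<i>\<close> times the derivative along \<open>w a\<close> is a momentum
  conjugate to that coordinate. Integrating by parts the field \<open>F = L x / \<rho>\<close> of length at most 1
  against \<open>\<bar>\<phi>\<bar>\<^sup>2\<close> turns \<open>(div F) \<bar>\<phi>\<bar>\<^sup>2\<close>, which dominates \<open>(d - 1) \<bar>\<phi>\<bar>\<^sup>2 / \<rho>\<close>, into a product of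
  \<open>\<phi>\<close> and its derivatives, and \<open>weighted_inner_bound\<close> bounds that product. For \<open>\<epsilon> = 0\<close> and \<open>L\<close>
  the identity, equality holds for \<open>exp (- \<bar>x\<bar> / c)\<close>, the ground state of a hydrogen atom, so
  nothing is lost for a single pair. The parameter \<open>\<epsilon>\<close> makes the field smooth and the potential bounded.
\<close>

lemma smoothed_coulomb_bound_test_function:
  fixes \<phi> :: "'a::euclidean_space \<Rightarrow> complex" and L :: "'a \<Rightarrow> real^'d" and w :: "'d \<Rightarrow> 'a"
  assumes \<phi>: "test_function \<phi>" and L: "linear L" "\<And>a. L (w a) = axis a 1"
    and \<epsilon>: "\<epsilon> > 0" and c: "c > 0"
  shows "(real CARD('d) - 1) * (LINT x|lborel. (norm (\<phi> x))\<^sup>2 / sqrt ((norm (L x))\<^sup>2 + \<epsilon>\<^sup>2)) \<le>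
    c * (LINT x|lborel. (\<Sum>a\<in>UNIV. (norm (frechet_derivative \<phi> (at x) (w a)))\<^sup>2)) +
    (1 / c) * (LINT x|lborel. (norm (\<phi> x))\<^sup>2)"
proof -
  obtain R where "\<forall>x. x \<notin> cball 0 R \<longrightarrow> \<phi> x = 0 \<and> (\<forall>w. frechet_derivative \<phi> (at x) w = 0)"
    using test_function_support[OF \<phi>] ..
  then have R: "\<phi> x = 0" "frechet_derivative \<phi> (at x) w = 0" if "x \<notin> cball 0 R" for x w
    using that by simp_all
  define \<rho> where "\<rho> x = sqrt ((norm (L x))\<^sup>2 + \<epsilon>\<^sup>2)" for x
  define D where "D a x = frechet_derivative \<phi> (at x) (w a)" for a x
  define F where "F a x = L x $ a / \<rho> x" for a x
  define h where "h a x = F a x * (norm (\<phi> x))\<^sup>2" for a x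
  define h' where "h' a x = (1 / \<rho> x - (L x $ a)\<^sup>2 / \<rho> x ^ 3) * (norm (\<phi> x))\<^sup>2
      + F a x * (2 * (\<phi> x \<bullet> D a x))" for a x
  have pos: "(norm (L x))\<^sup>2 + \<epsilon>\<^sup>2 > 0" for x using \<epsilon> by (simp add: add_nonneg_pos)
  then have "\<rho> x > 0" for x by (simp add: \<rho>_def)
  then have \<rho>: "\<rho> x > 0" "\<rho> x \<noteq> 0" for x by (simp_all add: less_imp_neq[symmetric])
  have contL: "continuous_on UNIV L"
    using L(1) by (rule linear_continuous_on[OF linear_conv_bounded_linear[THEN iffD1]])
  have cont\<rho>: "continuous_on UNIV \<rho>"
    unfolding \<rho>_def by (intro continuous_intros contL)
  have contF: "continuous_on UNIV (F a)" for a
    unfolding F_def by (intro continuous_intros contL cont\<rho>) (simp add: \<rho>)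
  have contD: "continuous_on UNIV (D a)" for a
    unfolding D_def by (rule test_function_continuous_derivative[OF \<phi>])
  note cont\<phi> = test_function_differentiable(1)[OF \<phi>]
  have cont_h: "continuous_on UNIV (h a)" and cont_h': "continuous_on UNIV (h' a)" for a
    unfolding h_def h'_def
    by (intro continuous_intros contF contD cont\<phi> cont\<rho> contL; simp add: \<rho>)+
  have supp: "h a x = 0" "h' a x = 0" if "x \<notin> cball 0 R" for a x
    using R[OF that] by (simp_all add: h_def h'_def)
  have der: "((\<lambda>t. h a (x + t *\<^sub>R w a)) has_real_derivative h' a x) (at 0)" for a x
  proof -
    have Lt: "L (x + t *\<^sub>R w a) = L x + t *\<^sub>R axis a 1" for t
      using L by (simp add: linear_add linear_scale)
    have "((\<lambda>t. F a (x + t *\<^sub>R w a)) has_real_derivative (1 / \<rho> x - (L x $ a)\<^sup>2 / \<rho> x ^ 3)) (at 0)"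
      unfolding F_def \<rho>_def Lt by (rule has_real_derivative_smoothed_unit_vector[OF \<epsilon>])
    moreover have "((\<lambda>t. (norm (\<phi> (x + t *\<^sub>R w a)))\<^sup>2) has_real_derivative 2 * (\<phi> x \<bullet> D a x)) (at 0)"
      unfolding D_def
      by (rule has_real_derivative_norm_power2_along[OF test_function_has_derivative[OF \<phi>]])
    ultimately have "((\<lambda>t. h a (x + t *\<^sub>R w a)) has_real_derivative
        (1 / \<rho> x - (L x $ a)\<^sup>2 / \<rho> x ^ 3) * (norm (\<phi> (x + 0 *\<^sub>R w a)))\<^sup>2 +
        2 * (\<phi> x \<bullet> D a x) * F a (x + 0 *\<^sub>R w a)) (at 0)"
      unfolding h_def by (rule DERIV_mult)
    then show ?thesis by (simp add: h'_def mult_ac)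
  qed
  have int0: "(LINT x|lborel. h' a x) = 0" for a
    by (rule integral_directional_derivative_eq_0[OF der cont_h cont_h' supp])
  have int_h': "integrable lborel (h' a)" for a
    by (rule integrable_continuous_compact_support[OF cont_h' supp(2)])
  have int_D: "integrable lborel (\<lambda>x. \<Sum>a\<in>UNIV. (norm (D a x))\<^sup>2)"
    by (rule integrable_continuous_compact_support[of _ R])
       (auto simp: D_def R intro!: continuous_intros contD[unfolded D_def])
  have int_\<phi>: "integrable lborel (\<lambda>x. (norm (\<phi> x))\<^sup>2)"
    by (rule integrable_continuous_compact_support[of _ R]) (auto simp: R intro!: continuous_intros cont\<phi>)
  have int_q: "integrable lborel (\<lambda>x. (norm (\<phi> x))\<^sup>2 / \<rho> x)"
    by (rule integrable_continuous_compact_support[of _ R]) (auto simp: R \<rho> intro!: continuous_intros cont\<phi> cont\<rho>)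
  have sumL: "(\<Sum>a\<in>UNIV. (L x $ a)\<^sup>2) = (norm (L x))\<^sup>2" for x
    by (simp add: norm_vec_def L2_set_def sum_nonneg)
  have le: "(norm (L x))\<^sup>2 \<le> (\<rho> x)\<^sup>2" for x
    using pos[of x] by (simp add: \<rho>_def)
  \<comment> \<open>The terms \<open>h' a\<close> integrate to 0, so only the kinetic and mass terms survive integration.\<close>
  have pointwise: "(real CARD('d) - 1) * ((norm (\<phi> x))\<^sup>2 / \<rho> x) \<le>
      (\<Sum>a\<in>UNIV. h' a x) + (c * (\<Sum>a\<in>UNIV. (norm (D a x))\<^sup>2) + (1 / c) * (norm (\<phi> x))\<^sup>2)" for x
  proof -
    have "(norm (L x))\<^sup>2 / \<rho> x ^ 3 \<le> (\<rho> x)\<^sup>2 / \<rho> x ^ 3"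
      using le[of x] \<rho>[of x] by (simp add: divide_right_mono)
    also have "\<dots> = 1 / \<rho> x" using \<rho>[of x] by (simp add: field_simps power2_eq_square power3_eq_cube)
    finally have "(real CARD('d) - 1) * (1 / \<rho> x) \<le> real CARD('d) * (1 / \<rho> x) - (norm (L x))\<^sup>2 / \<rho> x ^ 3"
      by (simp add: algebra_simps)
    also have "\<dots> = (\<Sum>a\<in>UNIV. 1 / \<rho> x - (L x $ a)\<^sup>2 / \<rho> x ^ 3)"
      by (simp add: sum_subtractf sumL flip: sum_divide_distrib)
    finally have "(real CARD('d) - 1) * (1 / \<rho> x) * (norm (\<phi> x))\<^sup>2 \<le>
        (\<Sum>a\<in>UNIV. 1 / \<rho> x - (L x $ a)\<^sup>2 / \<rho> x ^ 3) * (norm (\<phi> x))\<^sup>2"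
      by (rule mult_right_mono) simp
    also have "\<dots> = (\<Sum>a\<in>UNIV. h' a x) + (\<Sum>a\<in>UNIV. - (F a x * (2 * (\<phi> x \<bullet> D a x))))"
      by (simp add: h'_def sum_distrib_right flip: sum.distrib)
    also have "(\<Sum>a\<in>UNIV. - (F a x * (2 * (\<phi> x \<bullet> D a x)))) \<le>
        (\<Sum>a\<in>UNIV. c * (norm (D a x))\<^sup>2 + (F a x)\<^sup>2 * (norm (\<phi> x))\<^sup>2 / c)"
      by (intro sum_mono weighted_inner_bound c)
    also have "\<dots> = c * (\<Sum>a\<in>UNIV. (norm (D a x))\<^sup>2) + (\<Sum>a\<in>UNIV. (F a x)\<^sup>2) * ((norm (\<phi> x))\<^sup>2 / c)"
      by (simp add: sum.distrib sum_distrib_left sum_distrib_right sum_divide_distrib)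
    also have "(\<Sum>a\<in>UNIV. (F a x)\<^sup>2) * ((norm (\<phi> x))\<^sup>2 / c) \<le> 1 * ((norm (\<phi> x))\<^sup>2 / c)"
    proof (rule mult_right_mono)
      show "(\<Sum>a\<in>UNIV. (F a x)\<^sup>2) \<le> 1"
        using le[of x] \<rho>[of x] by (simp add: F_def power_divide sumL flip: sum_divide_distrib)
    qed (use c in simp)
    finally show ?thesis by simp
  qed
  have "(LINT x|lborel. (real CARD('d) - 1) * ((norm (\<phi> x))\<^sup>2 / \<rho> x)) \<le>
    (LINT x|lborel. (\<Sum>a\<in>UNIV. h' a x) + (c * (\<Sum>a\<in>UNIV. (norm (D a x))\<^sup>2) + (1 / c) * (norm (\<phi> x))\<^sup>2))"
    by (intro integral_mono pointwise Bochner_Integration.integrable_add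
          Bochner_Integration.integrable_sum integrable_mult_right int_q int_h' int_D int_\<phi>)
  also have "\<dots> = c * (LINT x|lborel. (\<Sum>a\<in>UNIV. (norm (D a x))\<^sup>2)) + (1 / c) * (LINT x|lborel. (norm (\<phi> x))\<^sup>2)"
    using int_h' int_D int_\<phi> int0
    by (simp add: Bochner_Integration.integral_add Bochner_Integration.integral_sum)
  finally show ?thesis
    unfolding integral_mult_right_zero \<rho>_def D_def .
qed

section \<open>Convergence of quadratic expressions in mean square\<close>

lemma integrable_weighted_norm_power2:
  fixes u :: "'a::euclidean_space \<Rightarrow> 'b::euclidean_space" and T :: "'b \<Rightarrow> 'c::euclidean_space"
  assumes u: "square_integrable u" and T: "bounded_linear T"
    and m: "m \<in> borel_measurable borel" "\<And>x. 0 \<le> m x" "\<And>x. m x \<le> M"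
  shows "integrable lborel (\<lambda>x. m x * (norm (T (u x)))\<^sup>2)"
proof -
  obtain K where K: "\<And>v. norm (T v) \<le> norm v * K" and K0: "0 \<le> K"
    using bounded_linear.nonneg_bounded[OF T] by blast
  have um: "u \<in> borel_measurable borel" and ui: "integrable lborel (\<lambda>x. (norm (u x))\<^sup>2)"
    using u by (simp_all add: square_integrable_def)
  have Tm: "T \<in> borel_measurable borel"
    using T by (intro borel_measurable_continuous_onI linear_continuous_on)
  show ?thesis
  proof (rule Bochner_Integration.integrable_bound)
    show "integrable lborel (\<lambda>x. (M * K\<^sup>2) * (norm (u x))\<^sup>2)" using ui by simp
    show "(\<lambda>x. m x * (norm (T (u x)))\<^sup>2) \<in> borel_measurable lborel"
      using m(1) measurable_compose[OF um Tm] by simp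
    have "norm (m x * (norm (T (u x)))\<^sup>2) \<le> norm ((M * K\<^sup>2) * (norm (u x))\<^sup>2)" for x
    proof -
      have "(norm (T (u x)))\<^sup>2 \<le> (norm (u x) * K)\<^sup>2" using K by (intro power_mono) auto
      then have "m x * (norm (T (u x)))\<^sup>2 \<le> M * (norm (u x) * K)\<^sup>2"
        using m(2,3) order_trans[OF m(2) m(3)] by (intro mult_mono) auto
      moreover have "0 \<le> m x * (norm (T (u x)))\<^sup>2" using m(2) by simp
      ultimately show ?thesis by (simp add: power_mult_distrib mult_ac)
    qed
    then show "AE x in lborel. norm (m x * (norm (T (u x)))\<^sup>2) \<le> norm ((M * K\<^sup>2) * (norm (u x))\<^sup>2)"
      by (intro AE_I2)
  qed
qed

lemma square_integrable_diff:
  fixes u v :: "'a::euclidean_space \<Rightarrow> 'b::euclidean_space"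
  assumes u: "square_integrable u" and v: "square_integrable v"
  shows "square_integrable (\<lambda>x. u x - v x)"
proof -
  have m: "u \<in> borel_measurable borel" "v \<in> borel_measurable borel"
    and i: "integrable lborel (\<lambda>x. (norm (u x))\<^sup>2)" "integrable lborel (\<lambda>x. (norm (v x))\<^sup>2)"
    using u v by (simp_all add: square_integrable_def)
  have "integrable lborel (\<lambda>x. (norm (u x - v x))\<^sup>2)"
  proof (rule Bochner_Integration.integrable_bound)
    show "integrable lborel (\<lambda>x. 2 * (norm (u x))\<^sup>2 + 2 * (norm (v x))\<^sup>2)" using i by simp
    show "(\<lambda>x. (norm (u x - v x))\<^sup>2) \<in> borel_measurable lborel" using m by simp
    have "(norm (u x - v x))\<^sup>2 \<le> 2 * (norm (u x))\<^sup>2 + 2 * (norm (v x))\<^sup>2" for x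
      using norm_add_power2[of "u x" "- v x"] norm_add_power2[of "u x" "v x"]
        zero_le_power2[of "norm (u x + v x)"] by simp
    then show "AE x in lborel. norm ((norm (u x - v x))\<^sup>2) \<le> norm (2 * (norm (u x))\<^sup>2 + 2 * (norm (v x))\<^sup>2)"
      by (intro AE_I2) simp
  qed
  then show ?thesis using m by (simp add: square_integrable_def)
qed

lemma abs_diff_norm_power2_le:
  fixes a b :: "'a::real_inner"
  assumes "\<delta> > 0"
  shows "\<bar>(norm a)\<^sup>2 - (norm b)\<^sup>2\<bar> \<le> (1 + 1 / \<delta>) * (norm (a - b))\<^sup>2 + \<delta> * (norm b)\<^sup>2"
proof -
  have "(norm a)\<^sup>2 = (norm b)\<^sup>2 + 2 * ((a - b) \<bullet> b) + (norm (a - b))\<^sup>2"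
    using norm_add_power2[of b "a - b"] by (simp add: inner_commute)
  moreover have "- (2 * ((a - b) \<bullet> b)) \<le> \<delta> * (norm b)\<^sup>2 + (norm (a - b))\<^sup>2 / \<delta>"
    using weighted_inner_bound[OF assms, of 1 "a - b" b] by simp
  moreover have "2 * ((a - b) \<bullet> b) \<le> \<delta> * (norm b)\<^sup>2 + (norm (a - b))\<^sup>2 / \<delta>"
    using weighted_inner_bound[OF assms, of "-1" "a - b" b] by simp
  moreover have "0 \<le> (norm (a - b))\<^sup>2" by simp
  moreover have "(1 + 1 / \<delta>) * (norm (a - b))\<^sup>2 = (norm (a - b))\<^sup>2 + (norm (a - b))\<^sup>2 / \<delta>"
    by (simp add: algebra_simps)
  ultimately show ?thesis by linarith
qed

text \<open>
  Convergence in mean square passes to quadratic expressions with a bounded weight \<open>m\<close>. By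
  \<open>abs_diff_norm_power2_le\<close> the error is a multiple, depending on \<open>\<delta>\<close>, of a quantity that tends
  to 0, plus \<open>\<delta>\<close> times a fixed constant, and \<open>\<delta>\<close> is arbitrary. The Coulomb potential
  is not a bounded weight, which is why the limit is taken before the regularisation is removed.
\<close>

lemma L2_tendsto_weighted_integral:
  fixes f :: "nat \<Rightarrow> 'a::euclidean_space \<Rightarrow> 'b::euclidean_space" and T :: "'b \<Rightarrow> 'c::euclidean_space"
  assumes lim: "L2_tendsto f u" and f: "\<And>k. square_integrable (f k)" and u: "square_integrable u"
    and T: "bounded_linear T"
    and m: "m \<in> borel_measurable borel" "\<And>x. 0 \<le> m x" "\<And>x. m x \<le> M"
  shows "(\<lambda>k. LINT x|lborel. m x * (norm (T (f k x)))\<^sup>2) \<longlonglongrightarrow> (LINT x|lborel. m x * (norm (T (u x)))\<^sup>2)"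
proof -
  obtain K where K: "\<And>v. norm (T v) \<le> norm v * K" and K0: "0 \<le> K"
    using bounded_linear.nonneg_bounded[OF T] by blast
  have M: "0 \<le> M" using order_trans[OF m(2) m(3)] .
  define S where "S = (LINT x|lborel. m x * (norm (T (u x)))\<^sup>2)"
  define I where "I k = (LINT x|lborel. m x * (norm (T (f k x)))\<^sup>2)" for k
  define e where "e k = (LINT x|lborel. (norm (f k x - u x))\<^sup>2)" for k
  have e: "e \<longlonglongrightarrow> 0" using lim by (simp add: L2_tendsto_def e_def[abs_def])
  have S: "0 \<le> S" unfolding S_def using m(2) by (intro integral_nonneg_AE AE_I2) simp
  have est: "\<bar>I k - S\<bar> \<le> (1 + 1 / \<delta>) * (M * K\<^sup>2) * e k + \<delta> * S" if \<delta>: "\<delta> > 0" for k \<delta>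
  proof -
    have if1: "integrable lborel (\<lambda>x. m x * (norm (T (f k x)))\<^sup>2)"
      and iu: "integrable lborel (\<lambda>x. m x * (norm (T (u x)))\<^sup>2)"
      by (rule integrable_weighted_norm_power2[OF _ T m]; rule f u)+
    have ie: "integrable lborel (\<lambda>x. (norm (f k x - u x))\<^sup>2)"
      using square_integrable_diff[OF f u] by (simp add: square_integrable_def)
    have pw: "\<bar>m x * (norm (T (f k x)))\<^sup>2 - m x * (norm (T (u x)))\<^sup>2\<bar> \<le>
        (1 + 1 / \<delta>) * (M * K\<^sup>2) * (norm (f k x - u x))\<^sup>2 + \<delta> * (m x * (norm (T (u x)))\<^sup>2)" for x
    proof -
      have "T (f k x) - T (u x) = T (f k x - u x)"
        using T by (simp add: linear_simps)
      then have "norm (T (f k x) - T (u x)) \<le> norm (f k x - u x) * K" using K by simp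
      then have "(norm (T (f k x) - T (u x)))\<^sup>2 \<le> (norm (f k x - u x) * K)\<^sup>2"
        by (intro power_mono) auto
      then have "m x * (norm (T (f k x) - T (u x)))\<^sup>2 \<le> M * (norm (f k x - u x) * K)\<^sup>2"
        using m(2,3) M by (intro mult_mono) auto
      then have *: "(1 + 1 / \<delta>) * (m x * (norm (T (f k x) - T (u x)))\<^sup>2) \<le>
          (1 + 1 / \<delta>) * (M * (norm (f k x - u x) * K)\<^sup>2)"
        using \<delta> by (intro mult_left_mono) auto
      have "\<bar>m x * (norm (T (f k x)))\<^sup>2 - m x * (norm (T (u x)))\<^sup>2\<bar> =
          m x * \<bar>(norm (T (f k x)))\<^sup>2 - (norm (T (u x)))\<^sup>2\<bar>"
        using m(2)[of x] by (simp add: abs_mult flip: right_diff_distrib)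
      also have "\<dots> \<le> m x * ((1 + 1 / \<delta>) * (norm (T (f k x) - T (u x)))\<^sup>2 + \<delta> * (norm (T (u x)))\<^sup>2)"
        using m(2) by (intro mult_left_mono abs_diff_norm_power2_le \<delta>)
      also have "\<dots> = (1 + 1 / \<delta>) * (m x * (norm (T (f k x) - T (u x)))\<^sup>2) + \<delta> * (m x * (norm (T (u x)))\<^sup>2)"
        by (simp only: distrib_left mult_ac)
      also note *
      also have "(1 + 1 / \<delta>) * (M * (norm (f k x - u x) * K)\<^sup>2) = (1 + 1 / \<delta>) * (M * K\<^sup>2) * (norm (f k x - u x))\<^sup>2"
        by (simp only: power_mult_distrib mult_ac)
      finally show ?thesis by simp
    qed
    have "\<bar>I k - S\<bar> = \<bar>LINT x|lborel. m x * (norm (T (f k x)))\<^sup>2 - m x * (norm (T (u x)))\<^sup>2\<bar>"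
      using if1 iu by (simp add: I_def S_def)
    also have "\<dots> \<le> (LINT x|lborel. \<bar>m x * (norm (T (f k x)))\<^sup>2 - m x * (norm (T (u x)))\<^sup>2\<bar>)"
      by (rule integral_abs_bound)
    also have "\<dots> \<le> (LINT x|lborel. (1 + 1 / \<delta>) * (M * K\<^sup>2) * (norm (f k x - u x))\<^sup>2 + \<delta> * (m x * (norm (T (u x)))\<^sup>2))"
      using if1 iu ie by (intro integral_mono pw) auto
    also have "\<dots> = (1 + 1 / \<delta>) * (M * K\<^sup>2) * e k + \<delta> * S"
      using iu ie by (simp add: e_def S_def)
    finally show ?thesis .
  qed
  have "I \<longlonglongrightarrow> S"
  proof (rule LIMSEQ_I)
    fix r :: real assume r: "r > 0"
    define \<delta> where "\<delta> = r / (2 * (S + 1))"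
    have \<delta>: "\<delta> > 0" "\<delta> * S < r / 2 + r / 4"
      using r S by (simp_all add: \<delta>_def field_simps add_pos_nonneg)
    have "(\<lambda>k. (1 + 1 / \<delta>) * (M * K\<^sup>2) * e k) \<longlonglongrightarrow> (1 + 1 / \<delta>) * (M * K\<^sup>2) * 0"
      by (intro tendsto_intros e)
    then have "\<forall>\<^sub>F k in sequentially. (1 + 1 / \<delta>) * (M * K\<^sup>2) * e k < r / 4"
      by (rule order_tendstoD) (use r in simp)
    then obtain k0 where k0: "\<And>k. k \<ge> k0 \<Longrightarrow> (1 + 1 / \<delta>) * (M * K\<^sup>2) * e k < r / 4"
      unfolding eventually_sequentially by blast
    have "norm (I k - S) < r" if "k \<ge> k0" for k
      using est[OF \<delta>(1), of k] k0[OF that] \<delta>(2) unfolding real_norm_def by linarith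
    then show "\<exists>no. \<forall>n\<ge>no. norm (I n - S) < r" by blast
  qed
  then show ?thesis by (simp add: I_def[abs_def] S_def)
qed

section \<open>The Coulomb uncertainty inequality for a pair of particles\<close>

lemma test_function_square_integrable:
  assumes \<phi>: "test_function \<phi>"
  shows "square_integrable \<phi>"
proof -
  obtain R where R: "\<forall>x. x \<notin> cball 0 R \<longrightarrow> \<phi> x = 0 \<and> (\<forall>w. frechet_derivative \<phi> (at x) w = 0)"
    using test_function_support[OF \<phi>] ..
  note c = test_function_differentiable(1)[OF \<phi>]
  have "integrable lborel (\<lambda>x. (norm (\<phi> x))\<^sup>2)"
    by (rule integrable_continuous_compact_support[of _ R]) (use R in \<open>auto intro!: continuous_intros c\<close>)
  then show ?thesis using borel_measurable_continuous_onI[OF c] by (simp add: square_integrable_def)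
qed

lemma test_function_gradient_square_integrable:
  assumes \<phi>: "test_function \<phi>"
  shows "square_integrable (gradient \<phi>)"
proof -
  obtain R where R: "\<forall>x. x \<notin> cball 0 R \<longrightarrow> \<phi> x = 0 \<and> (\<forall>w. frechet_derivative \<phi> (at x) w = 0)"
    using test_function_support[OF \<phi>] ..
  have c: "continuous_on UNIV (gradient \<phi>)"
    unfolding gradient_def
    by (intro continuous_on_vec_lambda test_function_continuous_derivative \<phi>)
  have "gradient \<phi> x = 0" if "x \<notin> cball 0 R" for x
    using R that by (simp add: gradient_def vec_eq_iff)
  then have "integrable lborel (\<lambda>x. (norm (gradient \<phi> x))\<^sup>2)"
    by (intro integrable_continuous_compact_support[of _ R]) (auto intro!: continuous_intros c)
  then show ?thesis using borel_measurable_continuous_onI[OF c] by (simp add: square_integrable_def)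
qed

text \<open>
  Direction in which the relative coordinates move when particle \<open>k\<close> moves along axis \<open>a\<close>. When
  particle 0 moves, all positions relative to it move backwards.
\<close>

definition particle_direction :: "'n::finite option \<Rightarrow> 'd \<Rightarrow> real^'d^'n" where
  "particle_direction k a =
     (case k of None \<Rightarrow> - (\<Sum>i\<in>UNIV. axis i (axis a 1)) | Some i \<Rightarrow> axis i (axis a 1))"

lemma particle_gradients_gradient:
  fixes \<phi> :: "real^'d^'n::finite \<Rightarrow> complex"
  assumes "test_function \<phi>"
  shows "particle_gradients (gradient \<phi> x) $ k $ a = frechet_derivative \<phi> (at x) (particle_direction k a)"
proof -
  interpret linear "frechet_derivative \<phi> (at x)"
    using test_function_has_derivative[OF assms] has_derivative_linear by blast
  show ?thesis
    by (cases k) (simp_all add: particle_gradients_def gradient_def particle_direction_def neg sum)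
qed

lemma configuration_particle_direction:
  fixes i j k :: "'n::finite option" and a :: "'d::finite"
  shows "configuration (particle_direction k a) $ i - configuration (particle_direction k a) $ j =
    (of_bool (k = i) - of_bool (k = j)) *\<^sub>R (axis a 1 :: real^'d)"
proof -
  have s: "(\<Sum>i\<in>UNIV. axis i (axis a 1 :: real^'d)) $ l = axis a 1" for l :: 'n
    by (simp add: axis_def if_distrib[of "\<lambda>v. v $ _"] vec_eq_iff cong: if_cong)
  show ?thesis
    by (cases k; cases i; cases j)
       (auto simp: configuration_def particle_direction_def s axis_def vec_eq_iff)
qed

lemma linear_configuration_diff: "linear (\<lambda>x. configuration x $ i - configuration x $ j)"
  by (rule linearI; cases i; cases j) (simp_all add: configuration_def algebra_simps)

lemma linear_particle_gradients_diff:
  "linear (\<lambda>G::complex^'d^'n::finite. particle_gradients G $ i - particle_gradients G $ j)"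
  by (rule linearI; cases i; cases j)
     (simp_all add: particle_gradients_def sum.distrib scaleR_sum_right algebra_simps)

text \<open>
  The inequality for test functions, applied to the separation of particles \<open>i\<close> and \<open>j\<close>. Its
  conjugate momentum is half the difference of the two particle momenta, because moving \<open>i\<close>
  forwards and \<open>j\<close> backwards at unit speed changes the separation at speed 2; this gives the
  factor \<open>1 / 4\<close>. Both sides then pass to the limit along an approximating sequence of test
  functions.
\<close>

lemma smoothed_pair_bound:
  fixes u :: "real^'d^'n::finite \<Rightarrow> complex"
  assumes H: "H1_gradient u G" and ij: "i \<noteq> j" and \<epsilon>: "\<epsilon> > 0" and c: "c > 0"
  shows "(real CARD('d) - 1) *
      (LINT x|lborel. (norm (u x))\<^sup>2 / sqrt ((norm (configuration x $ i - configuration x $ j))\<^sup>2 + \<epsilon>\<^sup>2)) \<le>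
    c / 4 * (LINT x|lborel. (norm (particle_gradients (G x) $ i - particle_gradients (G x) $ j))\<^sup>2) +
    (1 / c) * (LINT x|lborel. (norm (u x))\<^sup>2)"
proof -
  obtain \<phi> where \<phi>: "\<And>k. test_function (\<phi> k)" and lim: "L2_tendsto \<phi> u" "L2_tendsto (\<lambda>k. gradient (\<phi> k)) G"
    and u: "square_integrable u" and G: "square_integrable G"
    using H unfolding H1_gradient_def by blast
  define L :: "real^'d^'n \<Rightarrow> real^'d" where "L x = configuration x $ i - configuration x $ j" for x
  define T :: "complex^'d^'n \<Rightarrow> complex^'d" where "T g = particle_gradients g $ i - particle_gradients g $ j" for g
  define w :: "'d \<Rightarrow> real^'d^'n" where
    "w a = (1/2) *\<^sub>R (particle_direction i a - particle_direction j a)" for a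
  define m where "m x = 1 / sqrt ((norm (L x))\<^sup>2 + \<epsilon>\<^sup>2)" for x
  have L: "linear L" unfolding L_def by (rule linear_configuration_diff)
  have T: "bounded_linear T"
    unfolding T_def by (rule linear_conv_bounded_linear[THEN iffD1, OF linear_particle_gradients_diff])
  have Lw: "L (w a) = axis a 1" for a
  proof -
    have "L (w a) = (1/2) *\<^sub>R (L (particle_direction i a) - L (particle_direction j a))"
      unfolding w_def using L by (simp add: linear_scale linear_diff)
    also have "\<dots> = (1/2) *\<^sub>R (axis a 1 + axis a 1)"
      using ij by (simp add: L_def configuration_particle_direction)
    also have "\<dots> = axis a 1" by (simp flip: scaleR_2)
    finally show ?thesis .
  qed
  have pos: "(norm (L x))\<^sup>2 + \<epsilon>\<^sup>2 > 0" for x using \<epsilon> by (simp add: add_nonneg_pos)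
  have contL: "continuous_on UNIV L"
    using L by (rule linear_continuous_on[OF linear_conv_bounded_linear[THEN iffD1]])
  have "continuous_on UNIV m"
    unfolding m_def by (intro continuous_intros contL) (use \<epsilon> in simp)
  then have m1: "m \<in> borel_measurable borel" by (rule borel_measurable_continuous_onI)
  have m2: "0 \<le> m x" for x using pos[of x] by (simp add: m_def)
  have m3: "m x \<le> 1 / \<epsilon>" for x
  proof -
    have "\<epsilon> \<le> sqrt ((norm (L x))\<^sup>2 + \<epsilon>\<^sup>2)" by (rule real_le_rsqrt) simp
    then show ?thesis unfolding m_def using \<epsilon> by (intro divide_left_mono) (simp_all add: pos)
  qed
  note \<phi>s = test_function_square_integrable[OF \<phi>] and gs = test_function_gradient_square_integrable[OF \<phi>]
  have id: "bounded_linear (\<lambda>z::complex. z)" by (rule bounded_linear_ident)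
  have l1: "(\<lambda>k. LINT x|lborel. m x * (norm (\<phi> k x))\<^sup>2) \<longlonglongrightarrow> (LINT x|lborel. m x * (norm (u x))\<^sup>2)"
    by (rule L2_tendsto_weighted_integral[OF lim(1) \<phi>s u id m1 m2 m3])
  have l2: "(\<lambda>k. LINT x|lborel. 1 * (norm (\<phi> k x))\<^sup>2) \<longlonglongrightarrow> (LINT x|lborel. 1 * (norm (u x))\<^sup>2)"
    by (rule L2_tendsto_weighted_integral[OF lim(1) \<phi>s u id, where M = 1]) auto
  have l3: "(\<lambda>k. LINT x|lborel. 1 * (norm (T (gradient (\<phi> k) x)))\<^sup>2) \<longlonglongrightarrow> (LINT x|lborel. 1 * (norm (T (G x)))\<^sup>2)"
    by (rule L2_tendsto_weighted_integral[OF lim(2) gs G T, where M = 1]) auto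
  have est: "(real CARD('d) - 1) * (LINT x|lborel. m x * (norm (\<phi> k x))\<^sup>2) \<le>
      c / 4 * (LINT x|lborel. 1 * (norm (T (gradient (\<phi> k) x)))\<^sup>2) + (1 / c) * (LINT x|lborel. 1 * (norm (\<phi> k x))\<^sup>2)" for k
  proof -
    have s: "(\<Sum>a\<in>UNIV. (norm (frechet_derivative (\<phi> k) (at x) (w a)))\<^sup>2) = (1/4) * (norm (T (gradient (\<phi> k) x)))\<^sup>2" for x
    proof -
      interpret D: linear "frechet_derivative (\<phi> k) (at x)"
        using test_function_has_derivative[OF \<phi>] has_derivative_linear by blast
      have "frechet_derivative (\<phi> k) (at x) (w a) = (1/2) *\<^sub>R (T (gradient (\<phi> k) x) $ a)" for a
        unfolding w_def D.scaleR D.diff by (simp add: T_def particle_gradients_gradient[OF \<phi>])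
      then have "(\<Sum>a\<in>UNIV. (norm (frechet_derivative (\<phi> k) (at x) (w a)))\<^sup>2) =
          (\<Sum>a\<in>UNIV. (1/4) * (norm (T (gradient (\<phi> k) x) $ a))\<^sup>2)"
        by (intro sum.cong) (simp_all add: power_mult_distrib power_divide)
      also have "\<dots> = (1/4) * (norm (T (gradient (\<phi> k) x)))\<^sup>2"
        unfolding norm_vec_def L2_set_def
        by (simp add: sum_nonneg flip: sum_distrib_left sum_divide_distrib)
      finally show ?thesis .
    qed
    show ?thesis
      using smoothed_coulomb_bound_test_function[OF \<phi>[of k] L Lw \<epsilon> c]
      unfolding s integral_mult_right_zero by (simp add: m_def)
  qed
  have "(real CARD('d) - 1) * (LINT x|lborel. m x * (norm (u x))\<^sup>2) \<le>
      c / 4 * (LINT x|lborel. 1 * (norm (T (G x)))\<^sup>2) + (1 / c) * (LINT x|lborel. 1 * (norm (u x))\<^sup>2)"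
  proof (rule LIMSEQ_le)
    show "(\<lambda>k. (real CARD('d) - 1) * (LINT x|lborel. m x * (norm (\<phi> k x))\<^sup>2)) \<longlonglongrightarrow>
        (real CARD('d) - 1) * (LINT x|lborel. m x * (norm (u x))\<^sup>2)"
      by (intro tendsto_intros l1)
    show "(\<lambda>k. c / 4 * (LINT x|lborel. 1 * (norm (T (gradient (\<phi> k) x)))\<^sup>2)
          + (1 / c) * (LINT x|lborel. 1 * (norm (\<phi> k x))\<^sup>2)) \<longlonglongrightarrow>
        c / 4 * (LINT x|lborel. 1 * (norm (T (G x)))\<^sup>2) + (1 / c) * (LINT x|lborel. 1 * (norm (u x))\<^sup>2)"
      by (intro tendsto_intros l2 l3)
  qed (use est in blast)
  then show ?thesis by (simp add: m_def L_def T_def)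
qed

text \<open>
  The regularised quotients increase to the Coulomb quotient as \<open>\<epsilon>\<close> decreases to 0, and their
  integrals are bounded uniformly, so monotone convergence yields both the inequality and the
  integrability of the Coulomb energy density on \<open>H\<^sup>1\<close>.
\<close>

lemma pair_bound:
  fixes u :: "real^'d^'n::finite \<Rightarrow> complex"
  assumes H: "H1_gradient u G" and ij: "i \<noteq> j" and d: "CARD('d) > 1" and c: "c > 0"
  defines "q \<equiv> \<lambda>x. (norm (u x))\<^sup>2 / norm (configuration x $ i - configuration x $ j)"
  shows "integrable lborel q"
    and "(real CARD('d) - 1) * (LINT x|lborel. q x) \<le>
      c / 4 * (LINT x|lborel. (norm (particle_gradients (G x) $ i - particle_gradients (G x) $ j))\<^sup>2) +
      (1 / c) * (LINT x|lborel. (norm (u x))\<^sup>2)"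
proof -
  define L :: "real^'d^'n \<Rightarrow> real^'d" where "L x = configuration x $ i - configuration x $ j" for x
  define B where "B = c / 4 * (LINT x|lborel. (norm (particle_gradients (G x) $ i - particle_gradients (G x) $ j))\<^sup>2) +
      (1 / c) * (LINT x|lborel. (norm (u x))\<^sup>2)"
  define \<epsilon> where "\<epsilon> n = inverse (real (Suc n))" for n
  have \<epsilon>: "\<epsilon> n > 0" for n by (simp add: \<epsilon>_def)
  have \<epsilon>_mono: "\<epsilon> n \<le> \<epsilon> m" if "m \<le> n" for m n
    unfolding \<epsilon>_def using that by (intro le_imp_inverse_le) auto
  have \<epsilon>_lim: "\<epsilon> \<longlonglongrightarrow> 0" unfolding \<epsilon>_def by (rule LIMSEQ_inverse_real_of_nat)
  define f where "f n x = (norm (u x))\<^sup>2 / sqrt ((norm (L x))\<^sup>2 + (\<epsilon> n)\<^sup>2)" for n x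
  \<comment> \<open>On the null set \<open>L x = 0\<close> the quotient \<open>q x\<close> is 0, being a division by 0, while \<open>f n x\<close> may
    diverge. Setting \<open>g n x = 0\<close> there gives convergence at every point.\<close>
  define g where "g n x = (if L x = 0 then 0 else f n x)" for n x
  have u: "u \<in> borel_measurable borel" "integrable lborel (\<lambda>x. (norm (u x))\<^sup>2)"
    using H by (simp_all add: H1_gradient_def square_integrable_def)
  have "continuous_on UNIV L"
    unfolding L_def
    by (rule linear_continuous_on[OF linear_conv_bounded_linear[THEN iffD1, OF linear_configuration_diff]])
  then have Lm[measurable]: "L \<in> borel_measurable borel" by (rule borel_measurable_continuous_onI)
  note um[measurable] = u(1)
  have f_int: "integrable lborel (f n)" for n
  proof (rule Bochner_Integration.integrable_bound)
    show "integrable lborel (\<lambda>x. (norm (u x))\<^sup>2 / \<epsilon> n)" using u(2) by simp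
    show "f n \<in> borel_measurable lborel" unfolding f_def by measurable
    have "\<epsilon> n \<le> sqrt ((norm (L x))\<^sup>2 + (\<epsilon> n)\<^sup>2)" for x by (rule real_le_rsqrt) simp
    then have "f n x \<le> (norm (u x))\<^sup>2 / \<epsilon> n" for x
      unfolding f_def using \<epsilon>[of n] by (intro divide_left_mono) (auto intro: mult_pos_pos less_le_trans)
    moreover have "0 \<le> f n x" for x by (simp add: f_def)
    ultimately show "AE x in lborel. norm (f n x) \<le> norm ((norm (u x))\<^sup>2 / \<epsilon> n)"
      using \<epsilon>[of n] by (intro AE_I2) simp
  qed
  have gm: "g n \<in> borel_measurable lborel" for n unfolding g_def f_def by measurable
  have g0: "0 \<le> g n x" and gf: "g n x \<le> f n x" for n x by (simp_all add: g_def f_def)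
  have g_int: "integrable lborel (g n)" for n
  proof (rule Bochner_Integration.integrable_bound[OF f_int[of n] gm])
    show "AE x in lborel. norm (g n x) \<le> norm (f n x)"
    proof (rule AE_I2)
      show "norm (g n x) \<le> norm (f n x)" for x using g0[of n x] gf[of n x] by simp
    qed
  qed
  have g_mono: "mono (\<lambda>n. g n x)" for x
  proof (rule monoI)
    fix m n :: nat assume "m \<le> n"
    then have "(\<epsilon> n)\<^sup>2 \<le> (\<epsilon> m)\<^sup>2" using \<epsilon>[of n] by (intro power_mono \<epsilon>_mono) auto
    then show "g m x \<le> g n x"
      unfolding g_def f_def by (auto intro!: divide_left_mono mult_pos_pos add_pos_nonneg)
  qed
  have g_lim: "(\<lambda>n. g n x) \<longlonglongrightarrow> q x" for x
  proof (cases "L x = 0")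
    case True
    then have "q x = 0" by (simp add: q_def L_def)
    with True show ?thesis by (simp add: g_def)
  next
    case False
    have "(\<lambda>n. f n x) \<longlonglongrightarrow> (norm (u x))\<^sup>2 / sqrt ((norm (L x))\<^sup>2 + 0\<^sup>2)"
      unfolding f_def by (intro tendsto_intros \<epsilon>_lim) (use False in simp)
    then show ?thesis using False by (simp add: g_def q_def L_def)
  qed
  have qm: "q \<in> borel_measurable lborel" using g_lim gm by (rule borel_measurable_LIMSEQ_metric[rotated])
  have bound: "(LINT x|lborel. g n x) \<le> B / (real CARD('d) - 1)" for n
  proof -
    have "(LINT x|lborel. g n x) \<le> (LINT x|lborel. f n x)"
      by (intro integral_mono g_int f_int gf)
    also have "(real CARD('d) - 1) * \<dots> \<le> B"
      using smoothed_pair_bound[OF H ij \<epsilon>[of n] c] by (simp add: f_def L_def B_def)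
    then have "(LINT x|lborel. f n x) \<le> B / (real CARD('d) - 1)"
      using d by (simp add: pos_le_divide_eq mult.commute)
    finally show ?thesis .
  qed
  have "incseq (\<lambda>n. LINT x|lborel. g n x)"
    using g_mono by (intro monoI integral_mono g_int) (auto dest: monoD)
  then obtain I where I: "(\<lambda>n. LINT x|lborel. g n x) \<longlonglongrightarrow> I"
    using incseq_convergent[of "\<lambda>n. LINT x|lborel. g n x" "B / (real CARD('d) - 1)"] bound by blast
  have "I \<le> B / (real CARD('d) - 1)" using I bound by (intro LIMSEQ_le_const2) auto
  then have I_le: "(real CARD('d) - 1) * I \<le> B"
    using d by (simp add: pos_le_divide_eq mult.commute)
  have "integrable lborel q" "(LINT x|lborel. q x) = I"
    by (rule integral_monotone_convergence_nonneg[OF g_int _ _ _ I qm];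
        intro AE_I2 g_mono g0 g_lim)+
  then show "integrable lborel q" "(real CARD('d) - 1) * (LINT x|lborel. q x) \<le> c / 4 * (LINT x|lborel. (norm (particle_gradients (G x) $ i - particle_gradients (G x) $ j))\<^sup>2) +
      (1 / c) * (LINT x|lborel. (norm (u x))\<^sup>2)"
    using I_le by (simp_all add: B_def)
qed

section \<open>Decomposition of the energy into pairs\<close>

lemma sum_pairs_norm_diff_power2:
  fixes g :: "'k::finite \<Rightarrow> 'a::real_inner"
  shows "(\<Sum>i\<in>UNIV. \<Sum>j\<in>UNIV. (norm (g i - g j))\<^sup>2) =
    2 * real CARD('k) * (\<Sum>k\<in>UNIV. (norm (g k))\<^sup>2) - 2 * (norm (\<Sum>k\<in>UNIV. g k))\<^sup>2"
proof -
  have "(norm (g i - g j))\<^sup>2 = (norm (g i))\<^sup>2 + (norm (g j))\<^sup>2 - 2 * (g i \<bullet> g j)" for i j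
    using norm_add_power2[of "g i" "- g j"] by simp
  then show ?thesis
    by (simp add: sum.distrib sum_subtractf power2_norm_eq_inner[of "sum g UNIV"] inner_sum_left
        inner_sum_right flip: sum_distrib_left) (rule sum.swap)
qed

lemma sum_particle_gradients: "(\<Sum>k\<in>UNIV. particle_gradients G $ k) = 0"
  by (simp add: sum_option particle_gradients_def)

text \<open>
  In the center-of-mass frame the momenta add up to 0, so the kinetic energy is a sum over pairs
  of squared momentum differences, just as the potential energy is a sum over pairs.
\<close>

lemma energy_density_pairs:
  fixes u :: complex and G :: "complex^'d^'n::finite" and r :: "real^'d^('n option)"
  shows "1/2 * (\<Sum>k\<in>UNIV. (norm (particle_gradients G $ k))\<^sup>2) + coulomb r * (norm u)\<^sup>2 =
    (\<Sum>i\<in>UNIV. \<Sum>j\<in>UNIV - {i}.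
       1 / (4 * (real CARD('n) + 1)) * (norm (particle_gradients G $ i - particle_gradients G $ j))\<^sup>2
       - 1/2 * ((norm u)\<^sup>2 / norm (r $ i - r $ j)))"
proof -
  let ?g = "\<lambda>k. particle_gradients G $ k"
  let ?N = "real CARD('n) + 1"
  have "(\<Sum>i\<in>UNIV. \<Sum>j\<in>UNIV - {i}. (norm (?g i - ?g j))\<^sup>2) = (\<Sum>i\<in>UNIV. \<Sum>j\<in>UNIV. (norm (?g i - ?g j))\<^sup>2)"
    by (intro sum.cong refl sum.mono_neutral_left) auto
  also have "\<dots> = 2 * ?N * (\<Sum>k\<in>UNIV. (norm (?g k))\<^sup>2)"
    using sum_pairs_norm_diff_power2[of ?g] by (simp add: sum_particle_gradients algebra_simps)
  finally have "1 / (4 * ?N) * (\<Sum>i\<in>UNIV. \<Sum>j\<in>UNIV - {i}. (norm (?g i - ?g j))\<^sup>2) =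
      1 / (4 * ?N) * (2 * ?N * (\<Sum>k\<in>UNIV. (norm (?g k))\<^sup>2))" by simp
  also have "\<dots> = 1/2 * (\<Sum>k\<in>UNIV. (norm (?g k))\<^sup>2)" by (simp add: divide_simps)
  finally have kin: "1/2 * (\<Sum>k\<in>UNIV. (norm (?g k))\<^sup>2) =
      (\<Sum>i\<in>UNIV. \<Sum>j\<in>UNIV - {i}. 1 / (4 * ?N) * (norm (?g i - ?g j))\<^sup>2)"
    by (simp only: sum_distrib_left)
  have "coulomb r * (norm u)\<^sup>2 = - (\<Sum>i\<in>UNIV. \<Sum>j\<in>UNIV - {i}. 1/2 * ((norm u)\<^sup>2 / norm (r $ i - r $ j)))"
    by (simp add: coulomb_def sum_distrib_left sum_distrib_right sum_negf norm_minus_commute)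
  then show ?thesis unfolding kin by (simp only: sum_subtractf)
qed

section \<open>The lower bound\<close>

theorem proposition4:
  fixes N d :: nat and e0 :: real
  assumes "N = CARD('n::finite) + 1" and "d = CARD('d::finite)"
    and "N \<ge> 2" and "d > 1"
    and "smallest_eigenvalue (reduced_hamiltonian :: (real^'d^'n \<Rightarrow> complex) rel) e0"
  shows "- (1 / (real d - 1)\<^sup>2) * (1/4) * (real N)\<^sup>2 * (real N - 1) \<le> e0"
proof -
  have N: "real N = real CARD('n) + 1" and d: "CARD('d) > 1" "real d - 1 > 0" "CARD('n option) = N"
    using assms(1-4) by simp_all
  obtain u G where u: "square_integrable u" and u0: "\<not> (AE x in lborel. u x = 0)"
    and H: "H1_gradient (u :: real^'d^'n \<Rightarrow> complex) G"
    and E: "energy_form u G u G = (LINT x|lborel. of_real e0 * u x * cnj (u x))"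
    using assms(5) unfolding smallest_eigenvalue_def eigenvalue_def reduced_hamiltonian_def by fast
  let ?g = "\<lambda>x k. particle_gradients (G x) $ k"
  let ?r = "\<lambda>x. configuration x :: real^'d^('n option)"
  define U where "U = (LINT x|lborel. (norm (u x))\<^sup>2)"
  define A where "A i j = (LINT x|lborel. (norm (?g x i - ?g x j))\<^sup>2)" for i j
  define P where "P i j = (LINT x|lborel. (norm (u x))\<^sup>2 / norm (?r x $ i - ?r x $ j))" for i j
  \<comment> \<open>With this weight, \<open>pair_bound\<close> divided by \<open>2 (d - 1)\<close> has the coefficient \<open>1 / (4 N)\<close> at
    the squared momentum difference that this pair has in the energy.\<close>
  define c where "c = 2 * (real d - 1) / real N"
  have N0: "real N > 0" using assms(3) by simp
  have c: "c > 0" using d(2) N0 by (simp add: c_def)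
  have G: "square_integrable G" using H by (simp add: H1_gradient_def)
  have A_int: "integrable lborel (\<lambda>x. (norm (?g x i - ?g x j))\<^sup>2)" for i j
    using integrable_weighted_norm_power2[OF G, of _ "\<lambda>_. 1" 1]
      linear_conv_bounded_linear[THEN iffD1, OF linear_particle_gradients_diff[of i j]]
    by simp
  note P_int = pair_bound(1)[OF H _ d(1) c]
  have U_int: "integrable lborel (\<lambda>x. (norm (u x))\<^sup>2)"
    using u by (simp add: square_integrable_def)
  have U0: "U > 0"
  proof -
    have "U \<noteq> 0"
      unfolding U_def using u0 U_int by (subst integral_nonneg_eq_0_iff_AE) auto
    moreover have "U \<ge> 0" unfolding U_def by simp
    ultimately show ?thesis by simp
  qed
  have pair: "- (real N / (4 * (real d - 1)\<^sup>2)) * U \<le> 1 / (4 * real N) * A i j - 1/2 * P i j" if "i \<noteq> j" for i j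
  proof -
    have "(real d - 1) * P i j \<le> c / 4 * A i j + (1 / c) * U"
      using pair_bound(2)[OF H that d(1) c] by (simp add: A_def P_def U_def assms(2))
    then have "P i j \<le> (c / 4 * A i j + (1 / c) * U) / (real d - 1)"
      using d(2) by (simp add: pos_le_divide_eq mult.commute)
    also have "\<dots> = 1 / (2 * real N) * A i j + real N / (2 * (real d - 1)\<^sup>2) * U"
    proof -
      have "(2 * D / n / 4 * A i j + 1 / (2 * D / n) * U) / D = 1 / (2 * n) * A i j + n / (2 * D\<^sup>2) * U"
        if "D > 0" "n > 0" for D n :: real
        using that by (simp add: field_simps power2_eq_square)
      from this[OF d(2) N0] show ?thesis unfolding c_def .
    qed
    finally show ?thesis by simp
  qed
  have "e0 * U = Re (LINT x|lborel. of_real e0 * u x * cnj (u x))"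
  proof -
    have "of_real e0 * u x * cnj (u x) = of_real (e0 * (norm (u x))\<^sup>2)" for x
      by (simp add: mult.assoc complex_norm_square del: of_real_power)
    then show ?thesis by (simp only: integral_complex_of_real) (simp add: U_def)
  qed
  also have "\<dots> = Re (energy_form u G u G)" by (simp add: E)
  also have "\<dots> = (LINT x|lborel. (\<Sum>i\<in>UNIV. \<Sum>j\<in>UNIV - {i}.
       1 / (4 * real N) * (norm (?g x i - ?g x j))\<^sup>2 - 1/2 * ((norm (u x))\<^sup>2 / norm (?r x $ i - ?r x $ j))))"
  proof -
    have "1/2 * (\<Sum>k\<in>UNIV. \<Sum>a\<in>UNIV. ?g x k $ a * cnj (?g x k $ a))
          + of_real (coulomb (?r x)) * u x * cnj (u x) =
        of_real (1/2 * (\<Sum>k\<in>UNIV. (norm (?g x k))\<^sup>2) + coulomb (?r x) * (norm (u x))\<^sup>2)" for x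
    proof -
      have "(norm v)\<^sup>2 = (\<Sum>a\<in>UNIV. (norm (v $ a))\<^sup>2)" for v :: "complex^'d"
        by (simp add: norm_vec_def L2_set_def sum_nonneg)
      then show ?thesis
        by (simp add: mult.assoc complex_norm_square[symmetric] flip: of_real_power)
    qed
    then show ?thesis
      unfolding energy_form_def by (simp only: integral_complex_of_real energy_density_pairs N Re_complex_of_real)
  qed
  also have "\<dots> = (\<Sum>i\<in>UNIV. \<Sum>j\<in>UNIV - {i}. 1 / (4 * real N) * A i j - 1/2 * P i j)"
  proof -
    have i: "integrable lborel (\<lambda>x. 1 / (4 * real N) * (norm (?g x i - ?g x j))\<^sup>2
        - 1/2 * ((norm (u x))\<^sup>2 / norm (?r x $ i - ?r x $ j)))" if "j \<in> UNIV - {i}" for i j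
      using that by (intro Bochner_Integration.integrable_diff integrable_mult_right A_int P_int) auto
    have v: "(LINT x|lborel. 1 / (4 * real N) * (norm (?g x i - ?g x j))\<^sup>2
        - 1/2 * ((norm (u x))\<^sup>2 / norm (?r x $ i - ?r x $ j))) = 1 / (4 * real N) * A i j - 1/2 * P i j"
      if "j \<in> UNIV - {i}" for i j
      unfolding A_def P_def integral_mult_right_zero[symmetric]
      using that by (intro Bochner_Integration.integral_diff integrable_mult_right A_int P_int) auto
    show ?thesis
      by (subst Bochner_Integration.integral_sum, intro Bochner_Integration.integrable_sum i, assumption)
         (intro sum.cong refl, subst Bochner_Integration.integral_sum, erule i, intro sum.cong refl v)
  qed
  also have "\<dots> \<ge> (\<Sum>i\<in>(UNIV :: 'n option set). \<Sum>j\<in>UNIV - {i}. - (real N / (4 * (real d - 1)\<^sup>2)) * U)"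
    by (intro sum_mono pair) auto
  also have "(\<Sum>i\<in>(UNIV :: 'n option set). \<Sum>j\<in>UNIV - {i}. - (real N / (4 * (real d - 1)\<^sup>2)) * U) =
      (- (1 / (real d - 1)\<^sup>2) * (1/4) * (real N)\<^sup>2 * (real N - 1)) * U"
  proof -
    have "real (card (UNIV - {i :: 'n option})) = real N - 1" for i
      using d(3) assms(3) by (simp add: card_Diff_singleton of_nat_diff)
    then have "(\<Sum>i\<in>(UNIV :: 'n option set). \<Sum>j\<in>UNIV - {i}. - (real N / (4 * (real d - 1)\<^sup>2)) * U) =
        real N * ((real N - 1) * (- (real N / (4 * (real d - 1)\<^sup>2)) * U))"
      by (simp only: sum_constant d(3))
    then show ?thesis by (simp add: field_simps power2_eq_square)
  qed
  finally show ?thesis using U0 by (rule mult_right_le_imp_le)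
qed

end
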